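(* Let $n\ge 1$ be an integer. If $m\ge 2$ is an even integer and $X=C^n(S^m\times I)$, then $$\mathrm{TC}_X(C^n(S^m)\times C^n(S^m))\le n+2.$$
   Context: $I=[0,1]$ and $S^m$ is the $m$-dimensional sphere. For a space $X$, $P(X)$ is the space of all continuous maps $\sigma\colon I\to X$ with the compact-open topology. For $A\subseteq X\times X$, $P_X(A)\subseteq P(X)$ is the subspace of paths $\sigma$ with $(\sigma(0),\sigma(1))\in A$, and $\mathrm{TC}_X(A)$ is the smallest integer $k$ such that $A$ has a cover by sets $U_1,\dots,U_k$ open in $A$ for which there are continuous maps $s_i\colon U_i\to P_X(A)$ with $s_i(x,y)(0)=x$ and $s_i(x,y)(1)=y$ for all $(x,y)\in U_i$; if no such $k$ exists, $\mathrm{TC}_X(A)=\infty$. (Paths may leave the subspaces in which their endpoints lie.) For any space $Z$, $C^n(Z)=\{(z_1,\dots,z_n)\in Z^n : z_i\neq z_j\text{ for }i\ne j\}$ with the subspace topology from $Z^n$. $S^m$ is identified with the subspace $S^m\times\{0\}$ of $S^m\times I$, and correspondingly $C^n(S^m)$ is viewed as a subspace of $C^n(S^m\times I)$ via $(y_1,\dots,y_n)\mapsto((y_1,0),\dots,(y_n,0))$. *)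

theory Defs
  imports "HOL-Analysis.Analysis" "HOL-Library.Extended_Nat"
begin

(* A path is represented by a function on the reals that is fixed (to undefined) outside [0,1],
   so that two paths are equal iff they agree on [0,1]. *)
definition paths :: "'a topology \<Rightarrow> (real \<Rightarrow> 'a) set" where
  "paths X = {\<sigma>. pathin X \<sigma> \<and> \<sigma> \<in> extensional {0..1}}"

(* P(X) with the compact-open topology, given by its standard subbasis. *)
definition path_space :: "'a topology \<Rightarrow> (real \<Rightarrow> 'a) topology" where
  "path_space X = topology_generated_by
     {{\<sigma> \<in> paths X. \<sigma> ` K \<subseteq> U} |K U. compact K \<and> K \<subseteq> {0..1} \<and> openin X U}"

(* K = {} in the subbasis gives all of P(X). *)
lemma topspace_path_space: "topspace (path_space X) = paths X"
proof -
  have "paths X = {\<sigma> \<in> paths X. \<sigma> ` {} \<subseteq> {}}" by simp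
  moreover have "compact ({} :: real set)" "({} :: real set) \<subseteq> {0..1}" "openin X {}" by simp_all
  ultimately have "paths X \<in> {{\<sigma> \<in> paths X. \<sigma> ` K \<subseteq> U} |K U.
      compact K \<and> K \<subseteq> {0..1} \<and> openin X U}" by blast
  then show ?thesis
    unfolding path_space_def topology_generated_by_topspace by blast
qed

(* P_X(A); only the endpoints of the paths are constrained by A. *)
definition path_space_on :: "'a topology \<Rightarrow> ('a \<times> 'a) set \<Rightarrow> (real \<Rightarrow> 'a) topology" where
  "path_space_on X A = subtopology (path_space X) {\<sigma>. (\<sigma> 0, \<sigma> 1) \<in> A}"

definition has_motion_planner ::
    "'a topology \<Rightarrow> ('a \<times> 'a) set \<Rightarrow> ('a \<times> 'a) set \<Rightarrow> bool" where
  "has_motion_planner X A U \<longleftrightarrow>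
     (\<exists>s. continuous_map (subtopology (prod_topology X X) U) (path_space_on X A) s \<and>
          (\<forall>(x, y) \<in> U. s (x, y) 0 = x \<and> s (x, y) 1 = y))"

(* TC_X(A), intended for A a subset of topspace X \<times> topspace X.
   The infimum of the empty set is \<infinity>. *)
definition TC :: "'a topology \<Rightarrow> ('a \<times> 'a) set \<Rightarrow> enat" where
  "TC X A = Inf {enat k |k. \<exists>U :: nat \<Rightarrow> ('a \<times> 'a) set.
     (\<Union>i<k. U i) = A \<and>
     (\<forall>i<k. openin (subtopology (prod_topology X X) A) (U i) \<and> has_motion_planner X A (U i))}"

(* Indices run through 0, ..., n-1; tuples are undefined at all other indices. *)
definition conf_space :: "nat \<Rightarrow> 'a topology \<Rightarrow> (nat \<Rightarrow> 'a) topology" where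
  "conf_space n Z = subtopology (product_topology (\<lambda>_. Z) {..<n})
     {z. \<forall>i<n. \<forall>j<n. i \<noteq> j \<longrightarrow> z i \<noteq> z j}"

definition sphere_cylinder :: "nat \<Rightarrow> ((nat \<Rightarrow> real) \<times> real) topology" where
  "sphere_cylinder m = prod_topology (nsphere m) (top_of_set {0..1})"

(* C^n(S^m) as a subset of C^n(S^m \<times> I), via S^m = S^m \<times> {0}. *)
definition conf_sphere :: "nat \<Rightarrow> nat \<Rightarrow> (nat \<Rightarrow> (nat \<Rightarrow> real) \<times> real) set" where
  "conf_sphere n m =
     (\<lambda>y. restrict (\<lambda>i. (y i, 0)) {..<n}) ` topspace (conf_space n (nsphere m))"

end

theory Submission
  imports Defs
begin

text \<open>The interval factor makes collisions irrelevant: if the \<open>i\<close>-th point is at height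
  \<open>t (1 - t) / (i + 1)\<close> at time \<open>t\<close>, the points can move on the sphere independently of each other.
  A pair \<open>(x, y)\<close> of points of the sphere has type 0 if \<open>y \<noteq> - x\<close>, type 2 if \<open>(x, y) = (e\<^sub>0, - e\<^sub>0)\<close>
  and type 1 otherwise; for each type there is a continuous choice of a path from \<open>x\<close> to \<open>y\<close>, where
  type 1 uses a tangent field whose only zero is \<open>e\<^sub>0\<close>. Since the points of a configuration are
  distinct, at most one of them is \<open>e\<^sub>0\<close>, so the sum of the types of its \<open>n\<close> pairs is at most
  \<open>n + 1\<close> rather than \<open>2n\<close>. The strata given by different type vectors with the same sum are
  separated from each other, so they have disjoint open neighbourhoods, and one open set for each of the sums
  \<open>0, \<dots>, n + 1\<close> suffices.\<close>

section \<open>Motion planners\<close>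

text \<open>The tube lemma: projection along a compact factor is a closed map, and the bad points
  are the image of the closed complement of \<open>V\<close>.\<close>

lemma openin_compact_slices:
  assumes "compact_space K" and "openin (prod_topology K T) V"
  shows "openin T {z \<in> topspace T. \<forall>t\<in>topspace K. (t, z) \<in> V}"
proof -
  let ?C = "topspace (prod_topology K T) - V"
  have "closedin T (snd ` ?C)"
    using closed_map_snd[OF assms(1), of T] assms(2) unfolding closed_map_def by blast
  then have "openin T (topspace T - snd ` ?C)" by blast
  moreover have "topspace T - snd ` ?C = {z \<in> topspace T. \<forall>t\<in>topspace K. (t, z) \<in> V}"
    by (force simp: image_iff)
  ultimately show ?thesis by simp
qed

text \<open>One half of the exponential law. It suffices to check subbasic sets of the compact-open
  topology, whose preimages are open by the tube lemma.\<close>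

lemma continuous_map_curry_path_space:
  assumes H: "continuous_map (prod_topology (top_of_set {0..1}) T) X H"
  shows "continuous_map T (path_space X) (\<lambda>z. restrict (\<lambda>t. H (t, z)) {0..1})"
    (is "continuous_map _ _ ?h")
proof -
  let ?P = "prod_topology (top_of_set {0..1::real}) T"
  have paths: "?h z \<in> paths X" if "z \<in> topspace T" for z
  proof -
    have "continuous_map (top_of_set {0..1}) ?P (\<lambda>t. (t, z))"
      using that by (simp add: continuous_map_pairedI)
    then have "continuous_map (top_of_set {0..1}) X (\<lambda>t. H (t, z))"
      using continuous_map_compose[OF _ H] by (simp add: o_def)
    then have "continuous_map (top_of_set {0..1}) X (?h z)"
      by (rule continuous_map_eq) simp
    then show ?thesis by (simp add: paths_def pathin_def)
  qed
  have pre: "openin T (?h -` {\<sigma> \<in> paths X. \<sigma> ` K \<subseteq> U} \<inter> topspace T)"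
    if K: "compact K" "K \<subseteq> {0..1}" and U: "openin X U" for K U
  proof -
    \<comment> \<open>A condition on all \<open>t\<close> in \<open>K\<close> becomes a condition on
      all \<open>t\<close> in [0,1] by allowing \<open>t\<close> outside \<open>K\<close>. This
      keeps the set open because \<open>K\<close> is closed, and the compact factor is then [0,1]
      itself.\<close>
    let ?V = "{p \<in> topspace ?P. fst p \<in> - K} \<union> {p \<in> topspace ?P. H p \<in> U}"
    have "continuous_map ?P euclideanreal fst"
      using continuous_map_fst continuous_map_in_subtopology by blast
    then have "openin ?P {p \<in> topspace ?P. fst p \<in> - K}"
      using compact_imp_closed[OF K(1)] by (intro openin_continuous_map_preimage) auto
    moreover have "openin ?P {p \<in> topspace ?P. H p \<in> U}"
      by (rule openin_continuous_map_preimage[OF H U])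
    ultimately have "openin ?P ?V" by (rule openin_Un)
    then have "openin T {z \<in> topspace T. \<forall>t\<in>topspace (top_of_set {0..1}). (t, z) \<in> ?V}"
      by (intro openin_compact_slices) (simp_all add: compact_space_subtopology)
    also have "{z \<in> topspace T. \<forall>t\<in>topspace (top_of_set {0..1}). (t, z) \<in> ?V}
        = ?h -` {\<sigma> \<in> paths X. \<sigma> ` K \<subseteq> U} \<inter> topspace T"
      using K(2) by (auto simp: paths image_subset_iff subset_iff)
    finally show ?thesis .
  qed
  show ?thesis unfolding path_space_def
  proof (rule continuous_on_generated_topo)
    show "?h ` topspace T \<subseteq> \<Union> {{\<sigma> \<in> paths X. \<sigma> ` K \<subseteq> U} |K U.
        compact K \<and> K \<subseteq> {0..1} \<and> openin X U}"
      using paths topspace_path_space[of X] unfolding path_space_def topology_generated_by_topspace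
      by blast
  qed (use pre in auto)
qed

text \<open>Replaces the compact-open topology by joint continuity of a homotopy \<open>H\<close>.
  The prescribed ends together with \<open>U \<subseteq> A\<close> put the curried paths into
  \<open>P_X(A)\<close>.\<close>

lemma has_motion_plannerI:
  assumes UA: "U \<subseteq> A"
    and H: "continuous_map
      (prod_topology (top_of_set {0..1::real}) (subtopology (prod_topology X X) U)) X H"
    and ends: "\<And>z. z \<in> U \<Longrightarrow> H (0, z) = fst z" "\<And>z. z \<in> U \<Longrightarrow> H (1, z) = snd z"
  shows "has_motion_planner X A U"
  unfolding has_motion_planner_def path_space_on_def
proof (intro exI conjI)
  show "continuous_map (subtopology (prod_topology X X) U)
      (subtopology (path_space X) {\<sigma>. (\<sigma> 0, \<sigma> 1) \<in> A}) (\<lambda>z. restrict (\<lambda>t. H (t, z)) {0..1})"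
    using continuous_map_curry_path_space[OF H] ends UA
    by (auto simp: continuous_map_in_subtopology)
qed (use ends in auto)

text \<open>On disjoint open sets the planners paste without any compatibility condition. This lets
  a single member of the cover serve all type vectors with the same sum.\<close>

lemma has_motion_planner_disjoint_Union:
  assumes open_U: "\<And>i. i \<in> I \<Longrightarrow> openin (subtopology (prod_topology X X) A) (U i)"
    and planner: "\<And>i. i \<in> I \<Longrightarrow> has_motion_planner X A (U i)"
    and disj: "disjoint_family_on U I"
  shows "has_motion_planner X A (\<Union>i\<in>I. U i)"
proof -
  let ?P = "prod_topology X X" and ?W = "\<Union>i\<in>I. U i"
  have UA: "U i \<subseteq> A" if "i \<in> I" for i
    using openin_subset[OF open_U[OF that]] by auto
  have "\<forall>i\<in>I. \<exists>f. continuous_map (subtopology ?P (U i)) (path_space_on X A) f \<and>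
      (\<forall>(x, y)\<in>U i. f (x, y) 0 = x \<and> f (x, y) 1 = y)"
    using planner by (simp add: has_motion_planner_def)
  then obtain s where "\<forall>i\<in>I. continuous_map (subtopology ?P (U i)) (path_space_on X A) (s i) \<and>
      (\<forall>(x, y)\<in>U i. s i (x, y) 0 = x \<and> s i (x, y) 1 = y)"
    by (rule bchoice[THEN exE])
  then have s: "continuous_map (subtopology ?P (U i)) (path_space_on X A) (s i)"
    and ends: "(x, y) \<in> U i \<Longrightarrow> s i (x, y) 0 = x \<and> s i (x, y) 1 = y" if "i \<in> I" for i x y
    using that by auto
  \<comment> \<open>By disjointness the choice has only one candidate on each
    \<open>U i\<close>.\<close>
  define g where "g z = s (SOME i. i \<in> I \<and> z \<in> U i) z" for z
  have g: "g z = s i z" if "i \<in> I" "z \<in> U i" for i z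
  proof -
    have "(SOME i. i \<in> I \<and> z \<in> U i) = i"
      using that disj unfolding disjoint_family_on_def by (intro some_equality) blast+
    then show ?thesis by (simp add: g_def)
  qed
  have "continuous_map (subtopology ?P ?W) (path_space_on X A) g"
  proof (rule pasting_lemma[where I = I and T = U and f = s])
    fix i assume i: "i \<in> I"
    have "openin (subtopology (subtopology ?P A) ?W) (U i)"
      using subset_openin_subtopology[OF open_U[OF i]] i by blast
    then show "openin (subtopology ?P ?W) (U i)"
      using UA by (simp add: subtopology_subtopology Int_absorb1 UN_subset_iff)
    show "continuous_map (subtopology (subtopology ?P ?W) (U i)) (path_space_on X A) (s i)"
      using s[OF i] i by (simp add: subtopology_subtopology Int_absorb1 UN_upper)
  next
    fix i j z assume "i \<in> I" "j \<in> I" "z \<in> topspace (subtopology ?P ?W) \<inter> U i \<inter> U j"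
    then show "s i z = s j z" using g by (metis IntE)
  next
    fix z assume "z \<in> topspace (subtopology ?P ?W)"
    then show "\<exists>j. j \<in> I \<and> z \<in> U j \<and> g z = s j z" using g by auto
  qed
  moreover have "\<forall>(x, y)\<in>?W. g (x, y) 0 = x \<and> g (x, y) 1 = y"
    using g ends by auto
  ultimately show ?thesis unfolding has_motion_planner_def by blast
qed

lemma openin_Collect_finite_ball:
  assumes "finite I" and "\<And>i. i \<in> I \<Longrightarrow> openin T {z \<in> topspace T. Q i z}"
  shows "openin T {z \<in> topspace T. \<forall>i\<in>I. Q i z}"
proof -
  \<comment> \<open>The intersection with \<open>topspace T\<close> gives the right value also for
    empty \<open>I\<close>.\<close>
  have "openin T ((\<Inter>i\<in>I. {z \<in> topspace T. Q i z}) \<inter> topspace T)"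
    using assms by (rule openin_INT)
  also have "(\<Inter>i\<in>I. {z \<in> topspace T. Q i z}) \<inter> topspace T = {z \<in> topspace T. \<forall>i\<in>I. Q i z}"
    by auto
  finally show ?thesis .
qed

lemma openin_continuous_map_less:
  fixes f g :: "'a \<Rightarrow> real"
  assumes "continuous_map T euclideanreal f" and "continuous_map T euclideanreal g"
  shows "openin T {z \<in> topspace T. f z < g z}"
proof -
  have "continuous_map T euclideanreal (\<lambda>z. g z - f z)"
    using assms by (intro continuous_intros)
  then have "openin T {z \<in> topspace T. g z - f z \<in> {0<..}}"
    by (intro openin_continuous_map_preimage) auto
  then show ?thesis by simp
qed

section \<open>Paths between two points of the sphere\<close>

definition sq_norm :: "nat \<Rightarrow> (nat \<Rightarrow> real) \<Rightarrow> real" where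
  "sq_norm m u = (\<Sum>l\<le>m. (u l)\<^sup>2)"

text \<open>\<open>detour 1\<close> is the field \<open>(1 - x\<^sub>0) e\<^sub>1 + x\<^sub>1 (e\<^sub>0 - x)\<close>, tangent to the sphere and zero only at \<open>e\<^sub>0\<close>
  (a constant field seen through stereographic projection from \<open>e\<^sub>0\<close>).\<close>
definition detour :: "nat \<Rightarrow> (nat \<Rightarrow> real) \<Rightarrow> nat \<Rightarrow> real" where
  "detour k x l =
     (if k = 0 then 0
      else if k = 1 then (1 - x 0) * of_bool (l = 1) + x 1 * (of_bool (l = 0) - x l)
      else of_bool (l = 1))"

text \<open>The chord from \<open>x\<close> to \<open>y\<close>, pushed aside by a term that
  vanishes at both ends; it is projected to the sphere later. For \<open>k = 0\<close> the chord is
  kept. For antipodal pairs it runs through the origin: \<open>k = 1\<close> pushes along the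
  tangent field, and \<open>k = 2\<close> along the constant vector \<open>e_1\<close>, which serves
  at \<open>e_0\<close>, the zero of that field.\<close>

definition bent_path :: "nat \<Rightarrow> (nat \<Rightarrow> real) \<Rightarrow> (nat \<Rightarrow> real) \<Rightarrow> real \<Rightarrow> nat \<Rightarrow> real" where
  "bent_path k x y t l = (1 - t) * x l + t * y l + t * (1 - t) * detour k x l"

definition pair_type :: "nat \<Rightarrow> (nat \<Rightarrow> real) \<Rightarrow> (nat \<Rightarrow> real) \<Rightarrow> nat" where
  "pair_type m x y =
     (if sq_norm m (\<lambda>l. x l + y l) \<noteq> 0 then 0 else if x 0 \<noteq> 1 then 1 else 2)"

text \<open>For \<open>k \<le> 2\<close> and \<open>x\<close> on the sphere, a continuous
  nonnegative function whose zero set is the closed set of pairs of type at least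
  \<open>k\<close>.\<close>

definition type_defect :: "nat \<Rightarrow> nat \<Rightarrow> (nat \<Rightarrow> real) \<Rightarrow> (nat \<Rightarrow> real) \<Rightarrow> real" where
  "type_defect m k x y =
     of_bool (1 \<le> k) * sq_norm m (\<lambda>l. x l + y l) + of_bool (2 \<le> k) * (1 - x 0)"

lemma sq_norm_nonneg: "0 \<le> sq_norm m u"
  by (simp add: sq_norm_def sum_nonneg)

lemma sq_norm_eq_0_iff: "sq_norm m u = 0 \<longleftrightarrow> (\<forall>l\<le>m. u l = 0)"
  by (auto simp: sq_norm_def sum_nonneg_eq_0_iff)

lemma in_nsphere_iff: "x \<in> topspace (nsphere m) \<longleftrightarrow> sq_norm m x = 1 \<and> (\<forall>l>m. x l = 0)"
  by (simp add: nsphere sq_norm_def)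

lemma nsphere_coord_le_1:
  assumes "x \<in> topspace (nsphere m)"
  shows "x 0 \<le> 1"
proof -
  have "(x 0)\<^sup>2 \<le> sq_norm m x"
    unfolding sq_norm_def by (rule member_le_sum) auto
  then show ?thesis using assms by (simp add: in_nsphere_iff abs_square_le_1 abs_le_iff)
qed

text \<open>The first coordinate exhausts the norm, so the others vanish. Hence the test
  \<open>x 0 = 1\<close> in \<open>pair_type\<close> singles out the point
  \<open>e_0\<close>.\<close>

lemma nsphere_eq_if_coord_1:
  assumes "x \<in> topspace (nsphere m)" and "x 0 = 1"
  shows "x = (\<lambda>l. of_bool (l = 0))"
proof -
  have "sq_norm m x = (x 0)\<^sup>2 + (\<Sum>l\<in>{..m} - {0}. (x l)\<^sup>2)"
    unfolding sq_norm_def by (intro sum.remove) auto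
  then have "(\<Sum>l\<in>{..m} - {0}. (x l)\<^sup>2) = 0"
    using assms by (simp add: in_nsphere_iff)
  then have "\<forall>l\<in>{..m} - {0}. (x l)\<^sup>2 = 0"
    by (subst (asm) sum_nonneg_eq_0_iff) auto
  then have "x l = of_bool (l = 0)" for l
    using assms by (cases "l \<le> m") (auto simp: in_nsphere_iff)
  then show ?thesis by blast
qed

text \<open>The contributions \<open>(1 - x 0) * x 1\<close> and \<open>x 1 * x 0\<close> add up to
  \<open>x 1\<close>, which cancels against \<open>x 1\<close> times the squared norm 1.\<close>

lemma detour_orthogonal:
  assumes "x \<in> topspace (nsphere m)" and "m \<ge> 1"
  shows "(\<Sum>l\<le>m. x l * detour 1 x l) = 0"
proof -
  have "(\<Sum>l\<le>m. x l * detour 1 x l) =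
      (\<Sum>l\<le>m. (1 - x 0) * (if l = 1 then x l else 0) + x 1 * (if l = 0 then x l else 0)
         - x 1 * (x l)\<^sup>2)"
    by (rule sum.cong) (auto simp: detour_def algebra_simps power2_eq_square)
  also have "\<dots> = (1 - x 0) * x 1 + x 1 * x 0 - x 1 * sq_norm m x"
    using assms(2) by (simp add: sum.distrib sum_subtractf sq_norm_def flip: sum_distrib_left)
  finally show ?thesis using assms(1) by (simp add: in_nsphere_iff algebra_simps)
qed

text \<open>This makes normalization possible. In each of the three types, a zero could occur only
  at \<open>t = 1/2\<close>, and there the type excludes it.\<close>

lemma bent_path_nonzero:
  assumes x: "x \<in> topspace (nsphere m)" and y: "y \<in> topspace (nsphere m)"
    and m: "m \<ge> 1" and t: "t \<in> {0..1}"
  shows "sq_norm m (bent_path (pair_type m x y) x y t) \<noteq> 0"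
proof
  assume zero: "sq_norm m (bent_path (pair_type m x y) x y t) = 0"
  show False
  proof (cases "sq_norm m (\<lambda>l. x l + y l) = 0")
    case False
    with zero have eq: "(1 - t) * x l = - (t * y l)" if "l \<le> m" for l
      using that by (auto simp: sq_norm_eq_0_iff pair_type_def bent_path_def detour_def algebra_simps)
    \<comment> \<open>Comparing norms on both sides of \<open>eq\<close> gives
      \<open>(1 - t)^2 = t^2\<close>; at the midpoint \<open>eq\<close> then says that
      \<open>x\<close> and \<open>y\<close> are antipodal.\<close>
    have "(1 - t)\<^sup>2 * sq_norm m x = (\<Sum>l\<le>m. ((1 - t) * x l)\<^sup>2)"
      by (simp add: sq_norm_def sum_distrib_left power_mult_distrib)
    also have "\<dots> = (\<Sum>l\<le>m. (t * y l)\<^sup>2)"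
      by (rule sum.cong) (simp_all add: eq)
    also have "\<dots> = t\<^sup>2 * sq_norm m y"
      by (simp add: sq_norm_def sum_distrib_left power_mult_distrib)
    finally have "t = 1/2"
      using x y by (simp add: in_nsphere_iff power2_eq_square algebra_simps)
    with eq have "\<forall>l\<le>m. x l + y l = 0" by auto
    with False show False by (simp add: sq_norm_eq_0_iff)
  next
    case True
    then have y': "y l = - x l" if "l \<le> m" for l
      using that by (simp add: sq_norm_eq_0_iff add_eq_0_iff)
    show False
    proof (cases "x 0 = 1")
      case False
      with True zero y' have eq: "(1 - 2 * t) * x l + t * (1 - t) * detour 1 x l = 0" if "l \<le> m" for l
        using that by (auto simp: sq_norm_eq_0_iff pair_type_def bent_path_def algebra_simps)
      \<comment> \<open>The inner product with \<open>x\<close> removes the tangential term and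
        leaves \<open>1 - 2 * t\<close>.\<close>
      have "0 = (\<Sum>l\<le>m. x l * ((1 - 2 * t) * x l + t * (1 - t) * detour 1 x l))"
        using eq by simp
      also have "\<dots> = (1 - 2 * t) * sq_norm m x + t * (1 - t) * (\<Sum>l\<le>m. x l * detour 1 x l)"
        unfolding sq_norm_def sum_distrib_left sum.distrib[symmetric]
        by (rule sum.cong) (simp_all add: power2_eq_square algebra_simps)
      finally have "t = 1/2"
        using x detour_orthogonal[OF x m] by (simp add: in_nsphere_iff)
      with eq have det: "detour 1 x l = 0" if "l \<le> m" for l using that by fastforce
      \<comment> \<open>Coordinate 0 of the field forces \<open>x 1 = 0\<close>; coordinate 1 is
        then \<open>1 - x 0\<close>, which is not zero.\<close>
      have "x 1 * (1 - x 0) = 0" using det[of 0] by (simp add: detour_def)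
      with False have "x 1 = 0" by simp
      with det[of 1] m False show False by (simp add: detour_def)
    next
      case x0: True
      with True zero have eq: "bent_path 2 x y t l = 0" if "l \<le> m" for l
        using that by (auto simp: sq_norm_eq_0_iff pair_type_def)
      \<comment> \<open>Coordinate 0 is not affected by the push along \<open>e_1\<close> and equals
        \<open>1 - 2 * t\<close>. At the midpoint coordinate 1 is \<open>1/4\<close>, since
        \<open>x\<close> and \<open>y\<close> cancel.\<close>
      have "t = 1/2" using eq[of 0] x0 y'[of 0] by (simp add: bent_path_def detour_def)
      with eq[of 1] y'[of 1] m show False by (simp add: bent_path_def detour_def)
    qed
  qed
qed

lemma type_defect_nonneg:
  assumes "x \<in> topspace (nsphere m)"
  shows "0 \<le> type_defect m k x y"
  using nsphere_coord_le_1[OF assms] by (simp add: type_defect_def sq_norm_nonneg)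

lemma type_defect_eq_0_iff:
  assumes "x \<in> topspace (nsphere m)" and "k \<le> 2"
  shows "type_defect m k x y = 0 \<longleftrightarrow> k \<le> pair_type m x y"
proof -
  have "k = 0 \<or> k = 1 \<or> k = 2" using assms(2) by linarith
  then show ?thesis
    using nsphere_coord_le_1[OF assms(1)] sq_norm_nonneg[of m "\<lambda>l. x l + y l"]
    by (auto simp: type_defect_def pair_type_def add_nonneg_eq_0_iff)
qed

lemma continuous_map_sq_norm:
  assumes "\<And>l. continuous_map T euclideanreal (\<lambda>p. f p l)"
  shows "continuous_map T euclideanreal (\<lambda>p. sq_norm m (f p))"
  unfolding sq_norm_def by (intro continuous_intros assms) auto

lemma continuous_map_bent_path:
  assumes f: "\<And>l. continuous_map T euclideanreal (\<lambda>p. f p l)"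
    and g: "\<And>l. continuous_map T euclideanreal (\<lambda>p. g p l)"
    and r: "continuous_map T euclideanreal r"
  shows "continuous_map T euclideanreal (\<lambda>p. bent_path k (f p) (g p) (r p) l)"
proof -
  have "continuous_map T euclideanreal (\<lambda>p. detour k (f p) l)"
    unfolding detour_def
    by (cases "k = 0"; cases "k = 1") (auto intro!: continuous_intros f)
  then show ?thesis
    unfolding bent_path_def by (intro continuous_intros f g r)
qed

lemma continuous_map_type_defect:
  assumes "\<And>l. continuous_map T euclideanreal (\<lambda>p. f p l)"
    and "\<And>l. continuous_map T euclideanreal (\<lambda>p. g p l)"
  shows "continuous_map T euclideanreal (\<lambda>p. type_defect m k (f p) (g p))"
  unfolding type_defect_def by (intro continuous_intros continuous_map_sq_norm assms)

lemma bent_path_ends: "bent_path k x y 0 = x" "bent_path k x y 1 = y"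
  by (simp_all add: bent_path_def fun_eq_iff)

lemma bent_path_outside:
  assumes "x \<in> topspace (nsphere m)" and "y \<in> topspace (nsphere m)" and "m \<ge> 1" and "l > m"
  shows "bent_path k x y t l = 0"
  using assms by (simp add: bent_path_def detour_def in_nsphere_iff)

lemma normalized_in_nsphere:
  assumes "sq_norm m u \<noteq> 0" and "\<And>l. l > m \<Longrightarrow> u l = 0"
  shows "(\<lambda>l. u l / sqrt (sq_norm m u)) \<in> topspace (nsphere m)"
proof -
  have "sq_norm m (\<lambda>l. u l / sqrt (sq_norm m u)) = (\<Sum>l\<le>m. (u l)\<^sup>2 / sq_norm m u)"
    unfolding sq_norm_def[of m "\<lambda>l. u l / sqrt (sq_norm m u)"]
    by (simp add: power_divide sq_norm_nonneg)
  also have "\<dots> = 1"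
    using assms(1) by (simp add: sq_norm_def flip: sum_divide_distrib)
  finally show ?thesis using assms(2) by (simp add: in_nsphere_iff)
qed

section \<open>Motion of configurations\<close>

type_synonym conf = "nat \<Rightarrow> (nat \<Rightarrow> real) \<times> real"

lemma conf_sphereD:
  assumes "a \<in> conf_sphere n m"
  shows "a \<in> topspace (conf_space n (sphere_cylinder m))"
    and "a \<in> extensional {..<n}"
    and "i < n \<Longrightarrow> fst (a i) \<in> topspace (nsphere m)"
    and "i < n \<Longrightarrow> snd (a i) = 0"
    and "\<lbrakk>i < n; j < n; fst (a i) = fst (a j)\<rbrakk> \<Longrightarrow> i = j"
  using assms
  by (auto simp: conf_sphere_def conf_space_def sphere_cylinder_def PiE_iff)

lemma continuous_map_conf_coord:
  assumes "i < n"
  shows "continuous_map (conf_space n (sphere_cylinder m)) euclideanreal (\<lambda>a. fst (a i) l)"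
proof -
  have "continuous_map (conf_space n (sphere_cylinder m)) (sphere_cylinder m) (\<lambda>a. a i)"
    unfolding conf_space_def using assms
    by (intro continuous_map_from_subtopology continuous_map_product_projection) simp
  moreover have "continuous_map (sphere_cylinder m) (nsphere m) fst"
    unfolding sphere_cylinder_def by (rule continuous_map_fst)
  ultimately have "continuous_map (conf_space n (sphere_cylinder m)) (nsphere m) (\<lambda>a. fst (a i))"
    using continuous_map_compose by (fastforce simp: o_def)
  then show ?thesis
    using continuous_map_compose[OF _ continuous_map_nsphere_projection] by (fastforce simp: o_def)
qed

lemma continuous_map_pair_coord:
  fixes i n m :: nat
  assumes "i < n"
  defines "X \<equiv> conf_space n (sphere_cylinder m)"
  shows "continuous_map (subtopology (prod_topology X X) U) euclideanreal (\<lambda>z. fst (fst z i) l)"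
    and "continuous_map (subtopology (prod_topology X X) U) euclideanreal (\<lambda>z. fst (snd z i) l)"
  using continuous_map_compose[OF continuous_map_fst continuous_map_conf_coord[OF assms(1), of m l], of X]
    continuous_map_compose[OF continuous_map_snd continuous_map_conf_coord[OF assms(1), of m l], of X]
  unfolding X_def by (auto simp: o_def intro!: continuous_map_from_subtopology)

text \<open>The types \<open>\<tau> i\<close> are parameters and are not computed from the pair, so
  the formula stays continuous on a neighbourhood of the stratum where they are the actual
  types.\<close>

definition pair_path ::
    "(nat \<Rightarrow> nat) \<Rightarrow> nat \<Rightarrow> real \<times> conf \<times> conf \<Rightarrow> nat \<Rightarrow> real"
  where "pair_path \<tau> i = (\<lambda>(t, a, b). bent_path (\<tau> i) (fst (a i)) (fst (b i)) t)"

lemma continuous_map_pair_path: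
  fixes i n m :: nat
  assumes "i < n"
  defines "X \<equiv> conf_space n (sphere_cylinder m)"
  shows "continuous_map (prod_topology (top_of_set {0..1::real}) (subtopology (prod_topology X X) U))
    euclideanreal (\<lambda>p. pair_path \<tau> i p l)"
proof -
  let ?T = "subtopology (prod_topology X X) U"
  have snd: "continuous_map (prod_topology (top_of_set {0..1::real}) ?T) euclideanreal (\<lambda>p. f (snd p))"
    if "continuous_map ?T euclideanreal f" for f
    using continuous_map_compose[OF continuous_map_snd that] by (simp add: o_def)
  have "continuous_map (prod_topology (top_of_set {0..1::real}) ?T) euclideanreal fst"
    using continuous_map_fst continuous_map_in_subtopology by blast
  then show ?thesis
    unfolding pair_path_def case_prod_beta
    unfolding X_def
    by (intro continuous_map_bent_path snd[unfolded X_def] continuous_map_pair_coord[OF assms(1)])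
qed

definition conf_motion ::
    "nat \<Rightarrow> nat \<Rightarrow> (nat \<Rightarrow> nat) \<Rightarrow> real \<times> conf \<times> conf \<Rightarrow> conf"
  where "conf_motion n m \<tau> p =
    (\<lambda>i\<in>{..<n}. (\<lambda>l. pair_path \<tau> i p l / sqrt (sq_norm m (pair_path \<tau> i p)),
                  fst p * (1 - fst p) / real (Suc i)))"

text \<open>Once the bent paths avoid the origin, they can be projected to the sphere point by
  point, and the heights in the interval factor keep the points apart.\<close>

lemma has_motion_planner_conf_motion:
  assumes m: "m \<ge> 1"
    and U: "U \<subseteq> conf_sphere n m \<times> conf_sphere n m"
    and nz: "\<And>z i t. \<lbrakk>z \<in> U; i < n; t \<in> {0..1}\<rbrakk> \<Longrightarrow> sq_norm m (pair_path \<tau> i (t, z)) \<noteq> 0"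
  shows "has_motion_planner (conf_space n (sphere_cylinder m))
    (conf_sphere n m \<times> conf_sphere n m) U"
proof (rule has_motion_plannerI[OF U])
  let ?X = "conf_space n (sphere_cylinder m)"
  let ?P = "prod_topology (top_of_set {0..1::real}) (subtopology (prod_topology ?X ?X) U)"
  have coord: "conf_motion n m \<tau> p i \<in> topspace (sphere_cylinder m)"
    if p: "p \<in> topspace ?P" and i: "i < n" for p i
  proof -
    obtain t a b where p_eq: "p = (t, a, b)" by (cases p)
    with p have t: "t \<in> {0..1}" and ab: "(a, b) \<in> U" by auto
    have xy: "fst (a i) \<in> topspace (nsphere m)" "fst (b i) \<in> topspace (nsphere m)"
      using ab U i by (auto dest: conf_sphereD(3))
    have "0 \<le> t * (1 - t) / real (Suc i)" using t by simp
    moreover have "t * (1 - t) / real (Suc i) \<le> 1"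
      using t mult_le_one[of t "1 - t"] by (simp add: divide_le_eq)
    moreover have "(\<lambda>l. pair_path \<tau> i p l / sqrt (sq_norm m (pair_path \<tau> i p))) \<in> topspace (nsphere m)"
      using nz[OF ab i t] bent_path_outside[OF xy m]
      by (intro normalized_in_nsphere) (simp_all add: p_eq pair_path_def)
    ultimately show ?thesis
      using i by (simp add: conf_motion_def sphere_cylinder_def p_eq)
  qed
  have distinct: "conf_motion n m \<tau> p i \<noteq> conf_motion n m \<tau> p j"
    if p: "p \<in> topspace ?P" and ij: "i < n" "j < n" "i \<noteq> j" for p i j
  proof
    assume eq: "conf_motion n m \<tau> p i = conf_motion n m \<tau> p j"
    obtain t a b where p_eq: "p = (t, a, b)" by (cases p)
    with p have ab: "(a, b) \<in> U" by auto
    then have conf: "a \<in> conf_sphere n m" "b \<in> conf_sphere n m" using U by auto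
    \<comment> \<open>Points of the sphere have norm 1, so normalization does not change the end
      configurations.\<close>
    have one: "sq_norm m (fst (a k)) = 1" "sq_norm m (fst (b k)) = 1" if "k < n" for k
      using conf_sphereD(3)[OF _ that] conf by (simp_all add: in_nsphere_iff)
    \<comment> \<open>Equal heights with different denominators must be zero. A collision could thus
      occur only at the ends, where the points are those of \<open>a\<close> or of
      \<open>b\<close>.\<close>
    from eq ij have "t * (1 - t) = 0"
      by (auto simp: conf_motion_def p_eq field_simps)
    then consider "t = 0" | "t = 1" by auto
    then show False
    proof cases
      case 1
      then have "fst (a i) = fst (a j)"
        using eq ij one by (simp add: conf_motion_def p_eq pair_path_def bent_path_ends)
      then show False using conf_sphereD(5)[OF conf(1)] ij by blast
    next
      case 2
      then have "fst (b i) = fst (b j)"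
        using eq ij one by (simp add: conf_motion_def p_eq pair_path_def bent_path_ends)
      then show False using conf_sphereD(5)[OF conf(2)] ij by blast
    qed
  qed
  have cont: "continuous_map ?P (sphere_cylinder m) (\<lambda>p. conf_motion n m \<tau> p i)" if i: "i < n" for i
  proof -
    let ?u = "\<lambda>p l. pair_path \<tau> i p l / sqrt (sq_norm m (pair_path \<tau> i p))"
    have "continuous_map ?P euclideanreal (\<lambda>p. ?u p l)" for l
      using nz[OF _ i]
      by (intro continuous_intros continuous_map_sq_norm continuous_map_pair_path[OF i]) auto
    then have "continuous_map ?P (powertop_real UNIV) ?u"
      by (simp add: continuous_map_componentwise_UNIV)
    moreover have "?u p \<in> topspace (nsphere m)" if "p \<in> topspace ?P" for p
      using coord[OF that i] i by (simp add: conf_motion_def sphere_cylinder_def)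
    ultimately have u: "continuous_map ?P (nsphere m) ?u"
      unfolding nsphere by (auto simp: continuous_map_in_subtopology)
    have "continuous_map ?P euclideanreal fst"
      using continuous_map_fst continuous_map_in_subtopology by blast
    then have "continuous_map ?P euclideanreal (\<lambda>p. fst p * (1 - fst p) / real (Suc i))"
      by (intro continuous_intros) auto
    moreover have "fst p * (1 - fst p) / real (Suc i) \<in> {0..1}" if "p \<in> topspace ?P" for p
      using coord[OF that i] i by (simp add: conf_motion_def sphere_cylinder_def)
    ultimately have "continuous_map ?P (top_of_set {0..1}) (\<lambda>p. fst p * (1 - fst p) / real (Suc i))"
      by (auto simp: continuous_map_in_subtopology)
    with u show ?thesis
      using i by (simp add: conf_motion_def sphere_cylinder_def continuous_map_pairedI)
  qed
  have "continuous_map ?P (product_topology (\<lambda>_. sphere_cylinder m) {..<n}) (conf_motion n m \<tau>)"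
    unfolding continuous_map_componentwise using cont by (simp add: image_subset_iff conf_motion_def)
  then show "continuous_map ?P ?X (conf_motion n m \<tau>)"
    using distinct unfolding conf_space_def[of n "sphere_cylinder m"]
    by (intro continuous_map_into_subtopology) blast+
next
  fix z assume "z \<in> U"
  then obtain a b where z: "z = (a, b)" and conf: "a \<in> conf_sphere n m" "b \<in> conf_sphere n m"
    using U by auto
  have one: "sq_norm m (fst (a k)) = 1" "sq_norm m (fst (b k)) = 1" if "k < n" for k
    using conf_sphereD(3)[OF _ that] conf by (simp_all add: in_nsphere_iff)
  show "conf_motion n m \<tau> (0, z) = fst z"
    by (rule extensionalityI[of _ "{..<n}"])
      (use conf_sphereD[OF conf(1)] one in
        \<open>auto simp: conf_motion_def pair_path_def bent_path_ends z prod_eq_iff\<close>)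
  show "conf_motion n m \<tau> (1, z) = snd z"
    by (rule extensionalityI[of _ "{..<n}"])
      (use conf_sphereD[OF conf(2)] one in
        \<open>auto simp: conf_motion_def pair_path_def bent_path_ends z prod_eq_iff\<close>)
qed

section \<open>The open cover\<close>

text \<open>The extensional function space makes the set finite and its members determined by their
  first \<open>n\<close> entries.\<close>

definition type_vectors :: "nat \<Rightarrow> nat \<Rightarrow> (nat \<Rightarrow> nat) set" where
  "type_vectors n j = {\<tau> \<in> {..<n} \<rightarrow>\<^sub>E {..2}. sum \<tau> {..<n} = j}"

definition conf_defect ::
    "nat \<Rightarrow> nat \<Rightarrow> (nat \<Rightarrow> nat) \<Rightarrow> conf \<times> conf \<Rightarrow> real"
  where "conf_defect n m \<tau> z = (\<Sum>i<n. type_defect m (\<tau> i) (fst (fst z i)) (fst (snd z i)))"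

text \<open>\<open>conf_defect n m \<tau>\<close> vanishes exactly where all types are at least those in \<open>\<tau>\<close>, so among the
  type vectors of sum \<open>j\<close> the one of a point of a stratum is the unique minimizer of the defect there.\<close>
definition type_region ::
    "nat \<Rightarrow> nat \<Rightarrow> nat \<Rightarrow> (nat \<Rightarrow> nat) \<Rightarrow> (conf \<times> conf) set"
  where "type_region n m j \<tau> =
    {z \<in> conf_sphere n m \<times> conf_sphere n m.
      (\<forall>i<n. \<forall>t\<in>{0..1}. sq_norm m (pair_path \<tau> i (t, z)) \<noteq> 0) \<and>
      (\<forall>\<rho>\<in>type_vectors n j - {\<tau>}. conf_defect n m \<tau> z < conf_defect n m \<rho> z)}"

lemma finite_type_vectors: "finite (type_vectors n j)"
  unfolding type_vectors_def by (simp add: finite_PiE)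

text \<open>Avoiding the origin for all \<open>t\<close> in [0,1] is an open condition by the tube
  lemma. Being the strict minimizer amounts to finitely many strict inequalities between continuous
  functions.\<close>

lemma openin_type_region:
  fixes n m
  defines "X \<equiv> conf_space n (sphere_cylinder m)" and "A \<equiv> conf_sphere n m \<times> conf_sphere n m"
  shows "openin (subtopology (prod_topology X X) A) (type_region n m j \<tau>)"
proof -
  let ?T = "subtopology (prod_topology X X) A"
  have top: "topspace ?T = A"
    using conf_sphereD(1) by (force simp: A_def X_def)
  have "openin ?T {z \<in> topspace ?T. \<forall>t\<in>{0..1}. sq_norm m (pair_path \<tau> i (t, z)) \<noteq> 0}"
    if "i < n" for i
  proof -
    let ?P = "prod_topology (top_of_set {0..1::real}) ?T"
    have "openin ?P {p \<in> topspace ?P. sq_norm m (pair_path \<tau> i p) \<in> - {0}}"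
      unfolding X_def
      by (intro openin_continuous_map_preimage[where Y = euclideanreal]
          continuous_map_sq_norm continuous_map_pair_path that) auto
    then have "openin ?T {z \<in> topspace ?T. \<forall>t\<in>topspace (top_of_set {0..1}).
        (t, z) \<in> {p \<in> topspace ?P. sq_norm m (pair_path \<tau> i p) \<in> - {0}}}"
      by (intro openin_compact_slices) (simp_all add: compact_space_subtopology)
    also have "{z \<in> topspace ?T. \<forall>t\<in>topspace (top_of_set {0..1}).
        (t, z) \<in> {p \<in> topspace ?P. sq_norm m (pair_path \<tau> i p) \<in> - {0}}}
      = {z \<in> topspace ?T. \<forall>t\<in>{0..1}. sq_norm m (pair_path \<tau> i (t, z)) \<noteq> 0}" by auto
    finally show ?thesis .
  qed
  then have 1: "openin ?T {z \<in> topspace ?T. \<forall>i\<in>{..<n}. \<forall>t\<in>{0..1}. sq_norm m (pair_path \<tau> i (t, z)) \<noteq> 0}"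
    by (intro openin_Collect_finite_ball[of "{..<n}"]) simp_all
  have "continuous_map ?T euclideanreal (conf_defect n m \<rho>)" for \<rho>
    unfolding conf_defect_def X_def
    by (intro continuous_intros continuous_map_type_defect continuous_map_pair_coord) auto
  then have 2: "openin ?T {z \<in> topspace ?T.
      \<forall>\<rho>\<in>type_vectors n j - {\<tau>}. conf_defect n m \<tau> z < conf_defect n m \<rho> z}"
    by (intro openin_Collect_finite_ball openin_continuous_map_less) (simp_all add: finite_type_vectors)
  have "type_region n m j \<tau> =
    {z \<in> topspace ?T. \<forall>i\<in>{..<n}. \<forall>t\<in>{0..1}. sq_norm m (pair_path \<tau> i (t, z)) \<noteq> 0} \<inter>
    {z \<in> topspace ?T. \<forall>\<rho>\<in>type_vectors n j - {\<tau>}. conf_defect n m \<tau> z < conf_defect n m \<rho> z}"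
    unfolding top by (auto simp: type_region_def A_def)
  then show ?thesis using openin_Int[OF 1 2] by simp
qed

text \<open>A strict minimizer of the defect is unique.\<close>

lemma disjoint_type_regions: "disjoint_family_on (type_region n m j) (type_vectors n j)"
proof -
  have "\<tau> = \<rho>" if "\<tau> \<in> type_vectors n j" "\<rho> \<in> type_vectors n j"
    "z \<in> type_region n m j \<tau>" "z \<in> type_region n m j \<rho>" for \<tau> \<rho> z
  proof (rule ccontr)
    assume "\<tau> \<noteq> \<rho>"
    with that have "conf_defect n m \<tau> z < conf_defect n m \<rho> z" "conf_defect n m \<rho> z < conf_defect n m \<tau> z"
      unfolding type_region_def by blast+
    then show False by simp
  qed
  then show ?thesis unfolding disjoint_family_on_def by blast
qed

lemma sum_pair_type_le:
  assumes a: "a \<in> conf_sphere n m"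
  shows "(\<Sum>i<n. pair_type m (fst (a i)) (fst (b i))) \<le> n + 1"
proof -
  let ?S = "{i \<in> {..<n}. fst (a i) 0 = 1}"
  have "fst (a i) = (\<lambda>l. of_bool (l = 0))" if "i \<in> ?S" for i
    using that nsphere_eq_if_coord_1[OF conf_sphereD(3)[OF a]] by simp
  then have "fst (a i) = fst (a j)" if "i \<in> ?S" "j \<in> ?S" for i j
    using that by metis
  then have "i = j" if "i \<in> ?S" "j \<in> ?S" for i j
    using that conf_sphereD(5)[OF a, of i j] by blast
  then have "card ?S \<le> 1" by (auto simp: card_le_Suc0_iff_eq)
  \<comment> \<open>Type 2 requires the first point of the pair to be \<open>e_0\<close>, which
    happens for at most one index because the points of \<open>a\<close> are distinct.\<close>
  have "(\<Sum>i<n. pair_type m (fst (a i)) (fst (b i))) \<le> (\<Sum>i<n. 1 + of_bool (fst (a i) 0 = 1))"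
    by (rule sum_mono) (auto simp: pair_type_def)
  also have "\<dots> = n + card ?S"
    unfolding sum.distrib by (simp add: sum_of_bool_eq Int_def)
  finally show ?thesis using \<open>card ?S \<le> 1\<close> by linarith
qed

text \<open>The witness is the vector of actual types. Its defect is zero and its bent paths avoid
  the origin, while any other vector of the same sum exceeds it in some entry and so has positive
  defect.\<close>

lemma type_region_cover:
  assumes m: "m \<ge> 1" and a: "a \<in> conf_sphere n m" and b: "b \<in> conf_sphere n m"
  obtains j \<tau> where "j < n + 2" and "\<tau> \<in> type_vectors n j" and "(a, b) \<in> type_region n m j \<tau>"
proof -
  define \<tau> where "\<tau> = (\<lambda>i\<in>{..<n}. pair_type m (fst (a i)) (fst (b i)))"
  define j where "j = sum \<tau> {..<n}"
  have "sum \<tau> {..<n} = (\<Sum>i<n. pair_type m (fst (a i)) (fst (b i)))"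
    by (simp add: \<tau>_def)
  then have j: "j < n + 2" using sum_pair_type_le[OF a, of b] by (simp add: j_def)
  have \<tau>: "\<tau> \<in> type_vectors n j"
    by (auto simp: type_vectors_def \<tau>_def j_def pair_type_def)
  have defect0: "conf_defect n m \<rho> (a, b) = 0 \<longleftrightarrow> (\<forall>i<n. \<rho> i \<le> \<tau> i)"
    if "\<rho> \<in> type_vectors n j" for \<rho>
  proof -
    have le2: "\<rho> i \<le> 2" if "i < n" for i
      using \<open>\<rho> \<in> type_vectors n j\<close> that by (auto simp: type_vectors_def)
    have "conf_defect n m \<rho> (a, b) = 0 \<longleftrightarrow>
        (\<forall>i\<in>{..<n}. type_defect m (\<rho> i) (fst (a i)) (fst (b i)) = 0)"
      unfolding conf_defect_def fst_conv snd_conv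
      by (intro sum_nonneg_eq_0_iff type_defect_nonneg conf_sphereD(3)[OF a]) simp_all
    then show ?thesis
      using type_defect_eq_0_iff[OF conf_sphereD(3)[OF a] le2] by (auto simp: \<tau>_def)
  qed
  have "conf_defect n m \<tau> (a, b) < conf_defect n m \<rho> (a, b)" if \<rho>: "\<rho> \<in> type_vectors n j - {\<tau>}" for \<rho>
  proof -
    have "conf_defect n m \<rho> (a, b) \<noteq> 0"
    proof
      assume "conf_defect n m \<rho> (a, b) = 0"
      then have le: "\<rho> i \<le> \<tau> i" if "i < n" for i using defect0 \<rho> that by blast
      have "\<rho> i = \<tau> i" if "i < n" for i
      proof (rule ccontr)
        assume "\<rho> i \<noteq> \<tau> i"
        \<comment> \<open>Entrywise comparison with one strict entry contradicts the equality of the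
          sums; this is why only vectors of one sum compete.\<close>
        then have "sum \<rho> {..<n} < sum \<tau> {..<n}"
          using le that by (intro sum_strict_mono_ex1) (auto simp: order_less_le)
        then show False using \<rho> by (simp add: type_vectors_def j_def)
      qed
      then have "\<rho> = \<tau>"
        using \<rho> \<tau> by (intro PiE_ext[of \<rho> "{..<n}" "\<lambda>_. {..2}"]) (auto simp: type_vectors_def)
      then show False using \<rho> by simp
    qed
    moreover have "0 \<le> conf_defect n m \<rho> (a, b)"
      unfolding conf_defect_def fst_conv
      by (intro sum_nonneg type_defect_nonneg conf_sphereD(3)[OF a]) simp
    moreover have "conf_defect n m \<tau> (a, b) = 0" using defect0[OF \<tau>] by simp
    ultimately show ?thesis by simp
  qed
  then have "(a, b) \<in> type_region n m j \<tau>"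
    using a b bent_path_nonzero[OF conf_sphereD(3)[OF a] conf_sphereD(3)[OF b] m]
    by (auto simp: type_region_def pair_path_def \<tau>_def)
  with j \<tau> show thesis by (rule that)
qed

theorem proposition3p5:
  fixes n m :: nat
  assumes "n \<ge> 1" and "m \<ge> 2" and "even m"
  shows "TC (conf_space n (sphere_cylinder m)) (conf_sphere n m \<times> conf_sphere n m) \<le> enat (n + 2)"
proof -
  let ?X = "conf_space n (sphere_cylinder m)" and ?A = "conf_sphere n m \<times> conf_sphere n m"
  \<comment> \<open>One open set for each sum \<open>j = 0, ..., n + 1\<close>, hence
    \<open>n + 2\<close> sets.\<close>
  define U where "U j = (\<Union>\<tau>\<in>type_vectors n j. type_region n m j \<tau>)" for j
  have "U j \<subseteq> ?A" for j by (auto simp: U_def type_region_def)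
  moreover have "?A \<subseteq> (\<Union>j<n + 2. U j)"
  proof
    fix z assume "z \<in> ?A"
    then obtain a b where z: "z = (a, b)" and ab: "a \<in> conf_sphere n m" "b \<in> conf_sphere n m"
      by blast
    have "m \<ge> 1" using assms(2) by simp
    then obtain j \<tau> where "j < n + 2" "\<tau> \<in> type_vectors n j" "(a, b) \<in> type_region n m j \<tau>"
      using ab by (rule type_region_cover)
    then show "z \<in> (\<Union>j<n + 2. U j)" unfolding U_def z by blast
  qed
  ultimately have "(\<Union>j<n + 2. U j) = ?A" by blast
  moreover have "openin (subtopology (prod_topology ?X ?X) ?A) (U j)" for j
    unfolding U_def using openin_type_region by blast
  moreover have "has_motion_planner ?X ?A (U j)" for j
    unfolding U_def
  proof (intro has_motion_planner_disjoint_Union openin_type_region disjoint_type_regions)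
    fix \<tau> assume "\<tau> \<in> type_vectors n j"
    show "has_motion_planner ?X ?A (type_region n m j \<tau>)"
      using assms(2) by (intro has_motion_planner_conf_motion[where \<tau> = \<tau>]) (auto simp: type_region_def)
  qed
  ultimately show ?thesis unfolding TC_def by (intro Inf_lower) blast
qed

end
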